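(* Let $\alpha,\beta,q\in\mathbb{Z}$ and let $(Z_n : NC^{\mathrm{(mton)}}(n)\to\mathbb{R})_{n\ge1}$ be recursive of the second kind with input $(\alpha,\beta;q)$. For $n\in\mathbb{N}$ let $L_n(t)=\sum_{(\pi,u)\in NC^{\mathrm{(mton)}}(n)} t^{Z_n(\pi,u)}$, $t>0$. Then for every $n\ge2$ and $t\in(0,\infty)$, $$L_n(t) = \bigl(q\,t^{\alpha} + ((n+1)-q)\,t^{\beta}\bigr) L_{n-1}(t) + \bigl(t^{\alpha+1} - t^{\beta+1}\bigr) L_{n-1}'(t).$$
   Context: $NC(n)$: non-crossing partitions of $\{1,\ldots,n\}$. For blocks $V,W$, "$V$ nested inside $W$" means $\min V>\min W$ and $\max V<\max W$. A monotonic ordering of $\pi\in NC(n)$ is a bijection $u:\pi\to\{1,\ldots,|\pi|\}$ with $u(V)>u(W)$ whenever $V$ is nested inside $W$; $NC^{\mathrm{(mton)}}(n)$ is the set of such pairs $(\pi,u)$. $J(\pi,u):=u^{-1}(|\pi|)$ (an interval). For $n\ge2$, the parent $\mathfrak{p}(\pi,u)=(\rho,v)\in NC^{\mathrm{(mton)}}(n-1)$: with $m=\max J(\pi,u)$ and $\phi$ the increasing bijection $\{1,\ldots,n\}\setminus\{m\}\to\{1,\ldots,n-1\}$, $\rho=\{\phi(V\setminus\{m\}) : V\in\pi, V\ne\{m\}\}$ and $v(\phi(V\setminus\{m\}))=u(V)$. For $(\rho,v)\in NC^{\mathrm{(mton)}}(n-1)$, $C(\rho,v):=\{(\pi,u)\in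 NC^{\mathrm{(mton)}}(n) : \mathfrak{p}(\pi,u)=(\rho,v)\}$ (it has exactly $n+1$ elements). A sequence $(Z_n : NC^{\mathrm{(mton)}}(n)\to\mathbb{R})$ is recursive of the second kind with input $(\alpha,\beta;q)$ if for every $n\ge2$ and $(\rho,v)\in NC^{\mathrm{(mton)}}(n-1)$ there is a subset $C_o(\rho,v)\subseteq C(\rho,v)$ such that $Z_n(\pi,u)=Z_{n-1}(\rho,v)+\alpha$ for $(\pi,u)\in C_o(\rho,v)$, $Z_n(\pi,u)=Z_{n-1}(\rho,v)+\beta$ for $(\pi,u)\in C(\rho,v)\setminus C_o(\rho,v)$, and $|C_o(\rho,v)|=Z_{n-1}(\rho,v)+q$. *)

theory Defs
  imports "HOL-Analysis.Analysis"
begin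

definition noncrossing :: "nat set set \<Rightarrow> bool" where
  "noncrossing \<pi> \<longleftrightarrow>
     (\<forall>V\<in>\<pi>. \<forall>W\<in>\<pi>. V \<noteq> W \<longrightarrow>
        \<not> (\<exists>a b c d. a < b \<and> b < c \<and> c < d \<and> a \<in> V \<and> c \<in> V \<and> b \<in> W \<and> d \<in> W))"

definition NC :: "nat \<Rightarrow> nat set set set" where
  "NC n = {\<pi>. partition_on {1..n} \<pi> \<and> noncrossing \<pi>}"

definition nested_in :: "nat set \<Rightarrow> nat set \<Rightarrow> bool" where
  "nested_in V W \<longleftrightarrow> Min V > Min W \<and> Max V < Max W"

text \<open>A monotonic ordering is a function on the set of blocks only; requiring it to be
  extensional (undefined off \<open>\<pi>\<close>) makes each ordering have exactly one representative.\<close>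

definition monotonic_ordering :: "nat set set \<Rightarrow> (nat set \<Rightarrow> nat) \<Rightarrow> bool" where
  "monotonic_ordering \<pi> u \<longleftrightarrow>
     u \<in> extensional \<pi> \<and> bij_betw u \<pi> {1..card \<pi>} \<and>
     (\<forall>V\<in>\<pi>. \<forall>W\<in>\<pi>. nested_in V W \<longrightarrow> u V > u W)"

type_synonym ordered_partition = "nat set set \<times> (nat set \<Rightarrow> nat)"

definition NC_mton :: "nat \<Rightarrow> ordered_partition set" where
  "NC_mton n = {(\<pi>, u). \<pi> \<in> NC n \<and> monotonic_ordering \<pi> u}"

definition last_block :: "ordered_partition \<Rightarrow> nat set" where
  "last_block = (\<lambda>(\<pi>, u). the_inv_into \<pi> u (card \<pi>))"

text \<open>For \<open>m \<in> {1..n}\<close> this restricts to the increasing bijection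
  from \<open>{1..n} - {m}\<close> onto \<open>{1..n-1}\<close>.\<close>

definition squeeze :: "nat \<Rightarrow> nat \<Rightarrow> nat" where
  "squeeze m i = (if i < m then i else i - 1)"

text \<open>The map \<open>V \<mapsto> squeeze m ` (V - {m})\<close> is injective on the blocks \<open>V \<noteq> {m}\<close>;
  the ordering of the parent is \<open>u\<close> transported along it.\<close>

definition parent :: "ordered_partition \<Rightarrow> ordered_partition" where
  "parent = (\<lambda>(\<pi>, u).
     let m = Max (last_block (\<pi>, u));
         f = (\<lambda>V. squeeze m ` (V - {m}));
         \<rho> = f ` (\<pi> - {{m}})
     in (\<rho>, restrict (\<lambda>B. u (the_inv_into (\<pi> - {{m}}) f B)) \<rho>))"

text \<open>\<open>children n (\<rho>, v)\<close> is meant for \<open>n \<ge> 2\<close> and \<open>(\<rho>, v) \<in> NC_mton (n - 1)\<close>: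
  the index is that of the children.\<close>

definition children :: "nat \<Rightarrow> ordered_partition \<Rightarrow> ordered_partition set" where
  "children n x = {y \<in> NC_mton n. parent y = x}"

text \<open>Only the values of \<open>Z n\<close> on \<open>NC_mton n\<close> for \<open>n \<ge> 1\<close> matter.\<close>

definition recursive_second_kind ::
    "real \<Rightarrow> real \<Rightarrow> real \<Rightarrow> (nat \<Rightarrow> ordered_partition \<Rightarrow> real) \<Rightarrow> bool" where
  "recursive_second_kind \<alpha> \<beta> q Z \<longleftrightarrow>
     (\<forall>n\<ge>2. \<forall>x\<in>NC_mton (n - 1). \<exists>C\<^sub>o \<subseteq> children n x.
        (\<forall>y\<in>C\<^sub>o. Z n y = Z (n - 1) x + \<alpha>) \<and>
        (\<forall>y\<in>children n x - C\<^sub>o. Z n y = Z (n - 1) x + \<beta>) \<and>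
        real (card C\<^sub>o) = Z (n - 1) x + q)"

definition gen_fun :: "(nat \<Rightarrow> ordered_partition \<Rightarrow> real) \<Rightarrow> nat \<Rightarrow> real \<Rightarrow> real" where
  "gen_fun Z n t = (\<Sum>x\<in>NC_mton n. t powr Z n x)"

end

theory Submission
  imports Defs
begin

text \<open>
  Replacing every point of \<open>{1..n}\<close> by the label of its block turns a monotonically ordered
  non-crossing partition into a word with letters \<open>1, \<dots>, k\<close>, all occurring, in which no letter lies
  between two equal larger ones. In this language the parent is obtained by erasing the last
  occurrence of the largest letter \<open>k\<close>. Since the occurrences of \<open>k\<close> are contiguous, a word of
  length \<open>n - 1\<close> arises either by erasing a single new letter \<open>k + 1\<close>, at any of the \<open>n\<close> possible
  places, or by erasing a repetition of its last \<open>k\<close>; so it has \<open>n + 1\<close> children. The recursion is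
  then the sum of
  \<open>(Z + q) t\<^bsup>Z + \<alpha>\<^esup> + (n + 1 - Z - q) t\<^bsup>Z + \<beta>\<^esup>\<close> over all parents, the factor \<open>Z\<close> being
  produced by the derivative.
\<close>

section \<open>Words\<close>

text \<open>A word of length \<open>n\<close> occupies the positions \<open>1, \<dots>, n\<close> and is \<open>0\<close> elsewhere.\<close>

definition words :: "nat \<Rightarrow> (nat \<Rightarrow> nat) set" where
  "words n = {w. (\<forall>i. w i \<noteq> 0 \<longleftrightarrow> 1 \<le> i \<and> i \<le> n) \<and> (\<exists>k. range w = {..k}) \<and>
     (\<forall>a b c. a < b \<and> b < c \<and> w a = w c \<longrightarrow> w a \<le> w b)}"

text \<open>The increasing enumeration of all naturals except \<open>m\<close>, with left inverse
  \<open>squeeze m\<close>. Precomposing a word with it deletes position \<open>m\<close> and closes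
  the gap.\<close>

definition skip :: "nat \<Rightarrow> nat \<Rightarrow> nat" where
  "skip m i = (if i < m then i else Suc i)"

text \<open>The outer \<open>Max\<close> is meaningful once the largest letter is nonzero: the
  filler letter 0 occupies infinitely many positions, every other letter finitely many.\<close>

definition last_max :: "(nat \<Rightarrow> nat) \<Rightarrow> nat" where
  "last_max w = Max (w -` {Max (range w)})"

definition erase_max :: "(nat \<Rightarrow> nat) \<Rightarrow> nat \<Rightarrow> nat" where
  "erase_max w = w \<circ> skip (last_max w)"

definition insert_letter :: "nat \<Rightarrow> nat \<Rightarrow> (nat \<Rightarrow> nat) \<Rightarrow> nat \<Rightarrow> nat" where
  "insert_letter m j w = (\<lambda>i. if i = m then j else w (squeeze m i))"

lemma words_nonzero_iff: "w \<in> words n \<Longrightarrow> w i \<noteq> 0 \<longleftrightarrow> 1 \<le> i \<and> i \<le> n"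
  unfolding words_def by blast

lemma words_range: "w \<in> words n \<Longrightarrow> \<exists>k. range w = {..k}"
  unfolding words_def by blast

lemma words_between: "w \<in> words n \<Longrightarrow> a < b \<Longrightarrow> b < c \<Longrightarrow> w a = w c \<Longrightarrow> w a \<le> w b"
  unfolding words_def by blast

lemma finite_fibre: "w \<in> words n \<Longrightarrow> j \<noteq> 0 \<Longrightarrow> finite (w -` {j})"
  by (rule finite_subset[of _ "{1..n}"]) (auto dest: words_nonzero_iff)

lemma Max_range_pos:
  assumes "w \<in> words n" "n \<ge> 1" "range w = {..k}"
  shows "k \<noteq> 0"
proof -
  have "w 1 \<noteq> 0" using words_nonzero_iff[OF assms(1), of 1] assms(2) by simp
  moreover have "w 1 \<in> {..k}" using assms(3) by blast
  ultimately show ?thesis by auto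
qed

section \<open>Deleting and reopening a position\<close>

lemma skip_neq [simp]: "skip m i \<noteq> m"
  by (simp add: skip_def)

lemma squeeze_skip [simp]: "squeeze m (skip m i) = i"
  by (simp add: skip_def squeeze_def)

lemma skip_squeeze [simp]: "i \<noteq> m \<Longrightarrow> skip m (squeeze m i) = i"
  by (auto simp: skip_def squeeze_def)

lemma range_skip: "range (skip m) = UNIV - {m}"
proof -
  have "i \<in> range (skip m)" if "i \<noteq> m" for i
    using that by (metis skip_squeeze rangeI)
  then show ?thesis by auto
qed

lemma skip_less_iff [simp]: "skip m i < skip m j \<longleftrightarrow> i < j"
  by (auto simp: skip_def)

lemma squeeze_less: "i < j \<Longrightarrow> i \<noteq> m \<Longrightarrow> j \<noteq> m \<Longrightarrow> squeeze m i < squeeze m j"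
  by (metis skip_less_iff skip_squeeze)

lemma insert_letter_skip: "insert_letter m j w \<circ> skip m = w"
  by (auto simp: insert_letter_def)

lemma insert_letter_eqI: "w \<circ> skip m = x \<Longrightarrow> w = insert_letter m (w m) x"
  by (auto simp: insert_letter_def)

lemma range_insert_letter: "range (insert_letter m j w) = insert j (range w)"
proof -
  have "range (insert_letter m j w) = insert j (insert_letter m j w ` range (skip m))"
    unfolding range_skip by (auto simp: insert_letter_def)
  also have "insert_letter m j w ` range (skip m) = range w"
    by (metis image_comp insert_letter_skip)
  finally show ?thesis .
qed

section \<open>The last occurrence of the largest letter\<close>

lemma last_max_eqI:
  assumes "range w = {..k}" "w m = k" "\<And>i. i > m \<Longrightarrow> w i \<noteq> k"
  shows "last_max w = m"
proof -
  have "w -` {k} \<subseteq> {..m}" using assms(3) by (metis atMost_iff not_less singletonD subsetI vimageD)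
  then have "finite (w -` {k})" by (rule finite_subset) simp
  moreover have "Max {..k} = k" by (rule Max_eqI) auto
  ultimately show ?thesis
    unfolding last_max_def assms(1) using assms \<open>w -` {k} \<subseteq> {..m}\<close>
    by (auto intro!: Max_eqI)
qed

lemma
  assumes "w \<in> words n" "n \<ge> 1" "range w = {..k}"
  shows word_last_max: "w (last_max w) = k"
    and word_after_last_max: "i > last_max w \<Longrightarrow> w i \<noteq> k"
    and last_max_pos: "1 \<le> last_max w"
    and last_max_le: "last_max w \<le> n"
proof -
  have k: "k \<noteq> 0" using Max_range_pos[OF assms] .
  have fin: "finite (w -` {k})" using finite_fibre[OF assms(1) k] .
  have "k \<in> range w" using assms(3) by simp
  then have "w -` {k} \<noteq> {}" by auto
  moreover have "Max {..k} = k" by (rule Max_eqI) auto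
  ultimately have "last_max w \<in> w -` {k}"
    unfolding last_max_def assms(3) using Max_in[OF fin] by simp
  then show 1: "w (last_max w) = k" by simp
  show "i > last_max w \<Longrightarrow> w i \<noteq> k"
    unfolding last_max_def assms(3) \<open>Max {..k} = k\<close>
    using Max_ge[OF fin, of i] by fastforce
  show "1 \<le> last_max w" "last_max w \<le> n"
    using 1 k words_nonzero_iff[OF assms(1)] by metis+
qed

text \<open>The letters still form an initial segment because a largest one is erased: either
  another \<open>k\<close> remains, or \<open>k - 1\<close> becomes the maximum. The order condition
  survives since \<open>skip\<close> is increasing.\<close>

lemma erase_max_in_words:
  assumes "w \<in> words n" "n \<ge> 1"
  shows "erase_max w \<in> words (n - 1)"
proof -
  obtain k where k: "range w = {..k}" using words_range assms by blast
  let ?m = "last_max w"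
  have m: "w ?m = k" "1 \<le> ?m" "?m \<le> n"
    using word_last_max[OF assms k] last_max_pos[OF assms k] last_max_le[OF assms k] by auto
  have range: "range (erase_max w) = w ` (UNIV - {?m})"
    unfolding erase_max_def range_skip[symmetric] by (simp add: image_comp)
  have "\<exists>k'. range (erase_max w) = {..k'}"
  proof (cases "\<exists>i. i \<noteq> ?m \<and> w i = k")
    case True
    then obtain i where "i \<noteq> ?m" "w i = w ?m" using m(1) by auto
    then have "w ` (UNIV - {?m}) = range w" by (auto simp: image_iff) (metis DiffI UNIV_I singletonD)
    then show ?thesis using range k by auto
  next
    case False
    then have "w ` (UNIV - {?m}) = {..k} - {k}" using k m(1) by blast
    also have "\<dots> = {..k - 1}" using Max_range_pos[OF assms k] by auto
    finally show ?thesis using range by auto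
  qed
  moreover have "erase_max w i \<noteq> 0 \<longleftrightarrow> 1 \<le> i \<and> i \<le> n - 1" for i
    using words_nonzero_iff[OF assms(1), of "skip ?m i"] m
    by (auto simp: erase_max_def skip_def)
  moreover have "erase_max w a \<le> erase_max w b"
    if "a < b" "b < c" "erase_max w a = erase_max w c" for a b c
    using words_between[OF assms(1), of "skip ?m a" "skip ?m b" "skip ?m c"] that
    by (simp add: erase_max_def)
  ultimately show ?thesis unfolding words_def by blast
qed

text \<open>The inserted letter is at least every other one, so it may lie between two equal
  letters. A new maximum is never an end of such a pair, and a repeated \<open>k\<close> right after
  its last occurrence inherits the condition from that occurrence.\<close>

lemma insert_letter_in_words:
  assumes x: "x \<in> words (n - 1)" "n \<ge> 2" "range x = {..k}"
    and m: "1 \<le> m" "m \<le> n"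
    and j: "j = Suc k \<or> j = k \<and> m = Suc (last_max x)"
  shows "insert_letter m j x \<in> words n" "erase_max (insert_letter m j x) = x"
proof -
  let ?w = "insert_letter m j x"
  have n1: "n - 1 \<ge> 1" using x(2) by simp
  have k: "k \<noteq> 0" using Max_range_pos[OF x(1) n1 x(3)] .
  have le: "x i \<le> k" for i using x(3) by (metis atMost_iff rangeI)
  have range: "range ?w = {..j}"
    using j x(3) by (auto simp: range_insert_letter)
  have after: "?w i \<noteq> j" if "i > m" for i
  proof (cases "j = Suc k")
    case True
    then show ?thesis using that le[of "squeeze m i"] by (auto simp: insert_letter_def)
  next
    case False
    then show ?thesis
      using j that word_after_last_max[OF x(1) n1 x(3), of "i - 1"]
      by (auto simp: insert_letter_def squeeze_def)
  qed
  have le_j: "x i \<le> j" for i using le[of i] j by auto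
  have between: "?w a \<le> ?w b" if abc: "a < b" "b < c" "?w a = ?w c" for a b c
  proof -
    consider "a = m" | "b = m" | "a \<noteq> m" "b \<noteq> m" "c = m" | "a \<noteq> m" "b \<noteq> m" "c \<noteq> m" by blast
    then show ?thesis
    proof cases
      case 1
      then show ?thesis using after[of c] abc by (simp add: insert_letter_def)
    next
      case 2
      then show ?thesis using le_j abc by (simp add: insert_letter_def)
    next
      \<comment> \<open>A letter equal to the inserted one occurs before it, so the inserted letter
        is the old maximum; the right end \<open>m\<close> of the pair can then be moved back to
        \<open>last_max x\<close>.\<close>
      case 3
      then have xa: "x a = j" using abc by (simp add: insert_letter_def squeeze_def)
      then have jk: "j = k" "m = Suc (last_max x)" using j le[of a] by auto
      have xm: "x (last_max x) = k" using word_last_max[OF x(1) n1 x(3)] .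
      have "b \<le> last_max x" using 3 abc jk by simp
      then have "x a \<le> x b"
        using words_between[OF x(1) abc(1), of "last_max x"] xa jk xm
        by (cases "b = last_max x") auto
      then show ?thesis using 3 abc by (simp add: insert_letter_def squeeze_def)
    next
      case 4
      then show ?thesis
        using words_between[OF x(1) squeeze_less[OF abc(1)] squeeze_less[OF abc(2)]] abc
        by (simp add: insert_letter_def)
    qed
  qed
  have "?w i \<noteq> 0 \<longleftrightarrow> 1 \<le> i \<and> i \<le> n" for i
  proof (cases "i = m")
    case True
    then show ?thesis using j m k by (auto simp: insert_letter_def)
  next
    case False
    then show ?thesis using words_nonzero_iff[OF x(1), of "squeeze m i"] m
      by (auto simp: insert_letter_def squeeze_def)
  qed
  then show "?w \<in> words n" using range between unfolding words_def by blast
  have "last_max ?w = m"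
    by (rule last_max_eqI[OF range _ after]) (simp add: insert_letter_def)
  then show "erase_max ?w = x" by (simp add: erase_max_def insert_letter_skip)
qed

text \<open>A preimage is recovered by putting its largest letter back where it was erased. If that
  letter is new, its position is free; if it still occurs in \<open>x\<close>, contiguity of its
  occurrences forces the erased copy to follow the last remaining one.\<close>

lemma erase_max_fibre:
  assumes x: "x \<in> words (n - 1)" "n \<ge> 2" "range x = {..k}"
  shows "{w \<in> words n. erase_max w = x} =
    insert (insert_letter (Suc (last_max x)) k x) ((\<lambda>m. insert_letter m (Suc k) x) ` {1..n})"
    (is "?L = insert ?g ?R")
proof (intro equalityI subsetI)
  have n1: "n - 1 \<ge> 1" using x(2) by simp
  fix w assume "w \<in> insert ?g ?R"
  then show "w \<in> ?L"
    using insert_letter_in_words[OF x] last_max_le[OF x(1) n1 x(3)] x(2)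
    by auto
next
  fix w assume "w \<in> ?L"
  then have w: "w \<in> words n" and wx: "w \<circ> skip (last_max w) = x"
    by (auto simp: erase_max_def)
  have n1: "n \<ge> 1" using x(2) by simp
  obtain K where K: "range w = {..K}" using words_range w by blast
  define m where "m = last_max w"
  have wm: "w m = K" "1 \<le> m" "m \<le> n" and after: "\<And>i. i > m \<Longrightarrow> w i \<noteq> K"
    using word_last_max[OF w n1 K] last_max_pos[OF w n1 K] last_max_le[OF w n1 K]
      word_after_last_max[OF w n1 K] by (auto simp: m_def)
  have weq: "w = insert_letter m K x"
    using insert_letter_eqI[OF wx] wm(1) by (simp add: m_def)
  \<comment> \<open>Both sides are the range of \<open>w\<close>, and an initial segment grows by at
    most one element when its new maximum is added.\<close>
  have "insert K {..k} = {..K}"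
    using range_insert_letter[of m K x] K x(3) weq by simp
  then have "K = k \<or> K = Suc k"
    by (metis atMost_iff atMost_Suc insert_iff le_Suc_eq le_antisym nat_le_linear not_less_eq_eq)
  then show "w \<in> insert ?g ?R"
  proof
    assume "K = Suc k"
    then show ?thesis using weq wm by auto
  next
    assume Kk: "K = k"
    have "k \<in> range x" using x(3) by simp
    then obtain i where "x i = k" by auto
    then have i: "w (skip m i) = k" using wx by (auto simp: m_def)
    have le: "w a \<le> k" for a using K Kk by (metis atMost_iff rangeI)
    have less: "skip m i < m"
      using i after[of "skip m i"] Kk skip_neq[of m i] by (meson linorder_neqE_nat)
    \<comment> \<open>A remaining \<open>k\<close> to the left of \<open>m - 1\<close>, paired with
      the one at \<open>m\<close>, forces the letter at \<open>m - 1\<close> to be at least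
      \<open>k\<close>, hence equal to it.\<close>
    have "w (m - 1) = k"
    proof (cases "skip m i = m - 1")
      case False
      then have "skip m i < m - 1" using less by simp
      from words_between[OF w this, of m] show ?thesis
        using i le[of "m - 1"] wm Kk by simp
    qed (use i in simp)
    then have "last_max x = m - 1"
      using wm after Kk wx
      by (intro last_max_eqI[OF x(3)]) (auto simp: m_def skip_def)
    then show ?thesis using weq wm Kk by simp
  qed
qed

text \<open>The letter \<open>Suc k\<close> marks the insertion position, so the \<open>n\<close>
  words of the family are distinct; the remaining word does not contain that letter.\<close>

lemma card_erase_max_fibre:
  assumes x: "x \<in> words (n - 1)" "n \<ge> 2"
  shows "card {w \<in> words n. erase_max w = x} = n + 1"
proof -
  obtain k where k: "range x = {..k}" using words_range x(1) by blast
  have le: "x i \<le> k" for i using k by (metis atMost_iff rangeI)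
  let ?f = "\<lambda>m. insert_letter m (Suc k) x"
  let ?g = "insert_letter (Suc (last_max x)) k x"
  have val: "?f m i = Suc k \<longleftrightarrow> i = m" for m i
    using le[of "squeeze m i"] by (simp add: insert_letter_def)
  have "inj_on ?f {1..n}" by (rule inj_onI) (metis val)
  moreover have "?g \<notin> ?f ` {1..n}"
  proof
    assume "?g \<in> ?f ` {1..n}"
    then obtain m where "?g = ?f m" by blast
    then have "?g m = Suc k" using val by metis
    then show False using le[of "squeeze (Suc (last_max x)) m"]
      by (auto simp: insert_letter_def split: if_splits)
  qed
  ultimately show ?thesis
    unfolding erase_max_fibre[OF x k] by (simp add: card_image)
qed

section \<open>Words and ordered partitions\<close>

definition fibres :: "(nat \<Rightarrow> nat) \<Rightarrow> nat set set" where
  "fibres w = (\<lambda>j. w -` {j}) ` (range w - {0})"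

text \<open>All points of a block carry the same letter, so its minimum serves as the sample point;
  \<open>restrict\<close> selects the extensional representative required of a monotonic
  ordering.\<close>

definition decode :: "(nat \<Rightarrow> nat) \<Rightarrow> ordered_partition" where
  "decode w = (fibres w, restrict (\<lambda>V. w (Min V)) (fibres w))"

lemma in_fibres_iff: "V \<in> fibres w \<longleftrightarrow> (\<exists>i. w i \<noteq> 0 \<and> V = w -` {w i})"
  by (auto simp: fibres_def)

lemma decode_label:
  assumes "w \<in> words n" "V \<in> fibres w" "i \<in> V"
  shows "snd (decode w) V = w i" "V = w -` {w i}" "w i \<noteq> 0"
proof -
  obtain j where j: "w j \<noteq> 0" "V = w -` {w j}"
    using assms(2) unfolding in_fibres_iff by blast
  have "Min V \<in> V"
    using Min_in[of V] finite_fibre[OF assms(1) j(1)] assms(3) j(2) by auto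
  then show "snd (decode w) V = w i" "V = w -` {w i}" "w i \<noteq> 0"
    using assms j by (auto simp: decode_def)
qed

lemma decode_fibre:
  assumes "w \<in> words n" "w i \<noteq> 0"
  shows "w -` {w i} \<in> fibres w" "snd (decode w) (w -` {w i}) = w i"
proof -
  show *: "w -` {w i} \<in> fibres w" using assms(2) unfolding in_fibres_iff by blast
  show "snd (decode w) (w -` {w i}) = w i"
    by (rule decode_label(1)[OF assms(1) *]) simp
qed

lemma decode_bij_betw:
  assumes "w \<in> words n" "range w = {..k}"
  shows "bij_betw (snd (decode w)) (fibres w) {1..k}" "card (fibres w) = k"
proof -
  have 1: "snd (decode w) (w -` {j}) = j" if j: "j \<in> range w - {0}" for j
    using decode_fibre(2)[OF assms(1)] j by blast
  have eq: "{1..k} = range w - {0}" using assms(2) by auto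
  show bij: "bij_betw (snd (decode w)) (fibres w) {1..k}"
    unfolding bij_betw_def
  proof
    show "inj_on (snd (decode w)) (fibres w)"
      unfolding fibres_def by (rule inj_onI) (auto simp: 1)
    show "snd (decode w) ` fibres w = {1..k}"
      unfolding fibres_def eq image_image by (auto simp: 1 image_iff)
  qed
  show "card (fibres w) = k" using bij_betw_same_card[OF bij] by simp
qed

text \<open>The single order condition on words yields both properties. For a crossing it applies in
  both directions and equates the two letters; for nested blocks, the minimum of the inner one lies
  between two points of the outer one.\<close>

lemma decode_in_NC_mton:
  assumes w: "w \<in> words n"
  shows "decode w \<in> NC_mton n"
proof -
  obtain k where k: "range w = {..k}" using words_range w by blast
  let ?u = "snd (decode w)"
  have part: "partition_on {1..n} (fibres w)"
  proof (rule partition_onI)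
    have "\<Union> (fibres w) = {i. w i \<noteq> 0}" unfolding fibres_def by auto
    then show "\<Union> (fibres w) = {1..n}"
      using words_nonzero_iff[OF w] by (simp add: atLeastAtMost_def atLeast_def atMost_def Collect_conj_eq)
    show "disjnt p q" if "p \<in> fibres w" "q \<in> fibres w" "p \<noteq> q" for p q
      using that by (auto simp: in_fibres_iff disjnt_def)
    show "{} \<notin> fibres w" by (auto simp: in_fibres_iff)
  qed
  have nc: "noncrossing (fibres w)"
    unfolding noncrossing_def
  proof (intro ballI impI notI; elim exE conjE)
    fix V W a b c d
    assume V: "V \<in> fibres w" and W: "W \<in> fibres w" and ne: "V \<noteq> W"
      and *: "a < b" "b < c" "c < d" "a \<in> V" "c \<in> V" "b \<in> W" "d \<in> W"
    have "w a = w c" "w b = w d"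
      using decode_label(1)[OF w V] decode_label(1)[OF w W] * by metis+
    with * have "w a = w b"
      using words_between[OF w, of a b c] words_between[OF w, of b c d] by simp
    then show False
      using ne decode_label(2)[OF w V \<open>a \<in> V\<close>] decode_label(2)[OF w W \<open>b \<in> W\<close>] by simp
  qed
  have mono: "?u V > ?u W" if V: "V \<in> fibres w" and W: "W \<in> fibres w" and "nested_in V W" for V W
  proof -
    have *: "Min V \<in> V" "Max V \<in> V" "Min V \<le> Max V" if "V \<in> fibres w" for V
    proof -
      have "finite V" "V \<noteq> {}" using that finite_fibre[OF w] by (auto simp: in_fibres_iff)
      then show "Min V \<in> V" "Max V \<in> V" "Min V \<le> Max V" by simp_all
    qed
    have l: "w (Min W) = ?u W" "w (Max W) = ?u W" "w (Min V) = ?u V"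
      using decode_label(1)[OF w W] decode_label(1)[OF w V] *[OF V] *[OF W] by metis+
    have lt: "Min W < Min V" "Min V < Max W"
      using that(3) *(3)[OF V] by (auto simp: nested_in_def)
    have "w (Min W) \<le> w (Min V)" using words_between[OF w lt] l by simp
    moreover have "w (Min W) \<noteq> w (Min V)"
      using decode_label(2)[OF w V *(1)[OF V]] decode_label(2)[OF w W *(1)[OF W]] lt by auto
    ultimately show ?thesis using l by simp
  qed
  have "monotonic_ordering (fibres w) ?u"
    unfolding monotonic_ordering_def
    using mono decode_bij_betw[OF w k] by (auto simp: decode_def)
  then show ?thesis using part nc by (auto simp: NC_mton_def NC_def decode_def)
qed

section \<open>Injectivity and surjectivity of decoding\<close>

lemma decode_inj: "inj_on decode (words n)"
proof (rule inj_onI)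
  fix w w' assume w: "w \<in> words n" and w': "w' \<in> words n" and eq: "decode w = decode w'"
  show "w = w'"
  proof
    fix i
    show "w i = w' i"
    proof (cases "w i = 0")
      case True
      then show ?thesis using words_nonzero_iff[OF w, of i] words_nonzero_iff[OF w', of i] by auto
    next
      case False
      have "w -` {w i} \<in> fibres w'"
        using decode_fibre(1)[OF w False] eq by (simp add: decode_def)
      then have "snd (decode w') (w -` {w i}) = w' i"
        by (rule decode_label(1)[OF w']) simp
      then show ?thesis using decode_fibre(2)[OF w False] eq by simp
    qed
  qed
qed

text \<open>Each point is given the label of its block. If a point of another block lies between two
  points of \<open>V\<close>, non-crossing traps that whole block between them, so it is nested in
  \<open>V\<close> and monotonicity gives it the larger label.\<close>

lemma decode_surj:
  assumes "x \<in> NC_mton n"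
  shows "\<exists>w\<in>words n. decode w = x"
proof -
  obtain \<pi> u where x: "x = (\<pi>, u)" by fastforce
  have part: "partition_on {1..n} \<pi>" and nc: "noncrossing \<pi>" and mo: "monotonic_ordering \<pi> u"
    using assms x by (auto simp: NC_mton_def NC_def)
  have bij: "bij_betw u \<pi> {1..card \<pi>}" and ext: "u \<in> extensional \<pi>"
    using mo by (auto simp: monotonic_ordering_def)
  define w where "w i = (if i \<in> {1..n} then u (THE V. V \<in> \<pi> \<and> i \<in> V) else 0)" for i
  have wV: "w i = u V" if "V \<in> \<pi>" "i \<in> V" for V i
  proof -
    have "(THE V. V \<in> \<pi> \<and> i \<in> V) = V"
      using that partition_onD2[OF part] by (intro the_equality) (auto simp: disjoint_def)
    moreover have "i \<in> {1..n}" using that partition_onD1[OF part] by blast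
    ultimately show ?thesis by (simp add: w_def)
  qed
  have ex: "\<exists>V\<in>\<pi>. i \<in> V" if "i \<in> {1..n}" for i
    using that partition_onD1[OF part] by blast
  have upos: "u V \<noteq> 0" if "V \<in> \<pi>" for V
    using bij_betwE[OF bij] that by fastforce
  have w0: "w i \<noteq> 0 \<longleftrightarrow> i \<in> {1..n}" for i
    using ex[of i] wV upos by (metis w_def)
  have fin: "finite V" if "V \<in> \<pi>" for V
    using that partition_onD1[OF part]
    by (metis Union_upper finite_atLeastAtMost finite_subset)
  have ne: "V \<noteq> {}" if "V \<in> \<pi>" for V
    using that partition_onD3[OF part] by blast
  have fib: "w -` {u V} = V" if "V \<in> \<pi>" for V
  proof (intro equalityI subsetI)
    fix i assume "i \<in> w -` {u V}"
    then have i: "w i = u V" by simp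
    then have "i \<in> {1..n}" using w0[of i] upos[OF \<open>V \<in> \<pi>\<close>] by simp
    then obtain W where W: "W \<in> \<pi>" "i \<in> W" using ex by blast
    then have "u W = u V" using wV i by simp
    then have "W = V" using bij W that by (auto simp: bij_betw_def inj_on_def)
    then show "i \<in> V" using W by simp
  qed (use wV that in auto)
  have w_range: "range w - {0} = u ` \<pi>"
  proof (intro equalityI subsetI)
    fix j assume "j \<in> range w - {0}"
    then obtain i where "j = w i" "i \<in> {1..n}" using w0 by auto
    then show "j \<in> u ` \<pi>" using ex wV by blast
  next
    fix j assume "j \<in> u ` \<pi>"
    then obtain V where "V \<in> \<pi>" "j = u V" by blast
    moreover from this obtain i where "i \<in> V" using ne by blast
    ultimately show "j \<in> range w - {0}" using wV upos by (metis DiffI rangeI singletonD)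
  qed
  \<comment> \<open>Position 0 contributes the value 0, which completes the labels
    \<open>{1..card \<pi>}\<close> to an initial segment.\<close>
  have "w 0 = 0" using w0[of 0] by auto
  then have "range w = insert 0 (range w - {0})" by (metis insert_Diff rangeI)
  then have "range w = {..card \<pi>}"
    unfolding w_range using bij by (auto simp: bij_betw_def)
  moreover have "w a \<le> w b" if abc: "a < b" "b < c" "w a = w c" for a b c
  proof (cases "w a = 0 \<or> w a = w b")
    case False
    then have "a \<in> {1..n}" "c \<in> {1..n}" using w0[of a] w0[of c] abc(3) by auto
    then have "b \<in> {1..n}" using abc by auto
    obtain V where V: "V \<in> \<pi>" "a \<in> V" using ex \<open>a \<in> {1..n}\<close> by blast
    obtain W where W: "W \<in> \<pi>" "b \<in> W" using ex \<open>b \<in> {1..n}\<close> by blast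
    have VW: "V \<noteq> W" using V W wV False by metis
    have c: "c \<in> V" using fib[OF V(1)] wV[OF V] abc(3) by auto
    \<comment> \<open>A point \<open>d\<close> beyond either end would give the crossing
      \<open>a < b < c < d\<close> or \<open>d < a < b < c\<close>; equality with an end is excluded
      by disjointness of the blocks.\<close>
    have inside: "a < d \<and> d < c" if "d \<in> W" for d
    proof -
      have "\<not> c < d" "\<not> d < a"
        using nc V W VW c that abc(1,2) unfolding noncrossing_def by blast+
      moreover have "d \<notin> V"
        using that V W VW partition_onD2[OF part] by (auto simp: disjoint_def)
      ultimately show ?thesis using V c by (metis linorder_neqE_nat)
    qed
    have "Min V \<le> a" "c \<le> Max V" using fin[OF V(1)] V c by simp_all
    moreover have "Min W \<in> W" "Max W \<in> W" using fin[OF W(1)] W ne by auto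
    ultimately have "nested_in W V"
      unfolding nested_in_def using inside[of "Min W"] inside[of "Max W"] by simp
    then have "u V < u W" using mo V W by (auto simp: monotonic_ordering_def)
    then show ?thesis using wV V W by simp
  qed auto
  ultimately have w: "w \<in> words n"
    unfolding words_def using w0 by auto
  have "fibres w = \<pi>"
    unfolding fibres_def w_range image_image using fib by simp
  moreover have "restrict (\<lambda>V. w (Min V)) \<pi> = u"
  proof (rule extensionalityI[OF _ ext])
    fix V assume "V \<in> \<pi>"
    then show "restrict (\<lambda>V. w (Min V)) \<pi> V = u V"
      using wV[of V "Min V"] fin ne by simp
  qed simp
  ultimately have "decode w = x" by (simp add: decode_def x)
  then show ?thesis using w by blast
qed

section \<open>Erasing a letter corresponds to taking the parent\<close>

lemma squeeze_fibre: "squeeze m ` (w -` {j} - {m}) = (w \<circ> skip m) -` {j}"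
proof (intro equalityI subsetI)
  fix i assume "i \<in> (w \<circ> skip m) -` {j}"
  then have "skip m i \<in> w -` {j} - {m}" by simp
  then show "i \<in> squeeze m ` (w -` {j} - {m})" by (metis imageI squeeze_skip)
next
  fix i assume "i \<in> squeeze m ` (w -` {j} - {m})"
  then obtain a where "a \<noteq> m" "w a = j" "i = squeeze m a" by auto
  then show "i \<in> (w \<circ> skip m) -` {j}" by simp
qed

text \<open>The last block is the fibre of the largest letter, so its maximum is
  \<open>last_max w\<close>. The block map of \<open>parent\<close> sends the fibre of each letter
  to its fibre in the erased word, which keeps the labels.\<close>

lemma parent_decode:
  assumes w: "w \<in> words n" and n: "n \<ge> 1"
  shows "parent (decode w) = decode (erase_max w)"
proof -
  obtain k where k: "range w = {..k}" using words_range w by blast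
  have k0: "k \<noteq> 0" using Max_range_pos[OF w n k] .
  have w': "erase_max w \<in> words (n - 1)" using erase_max_in_words[OF w n] .
  define m where "m = last_max w"
  define f where "f V = squeeze m ` (V - {m})" for V
  let ?w' = "erase_max w" and ?u = "restrict (\<lambda>V. w (Min V)) (fibres w)"
  let ?P = "fibres w - {{m}}"
  have u: "?u = snd (decode w)" by (simp add: decode_def)
  have wm: "w m = k" using word_last_max[OF w n k] by (simp add: m_def)
  have "the_inv_into (fibres w) ?u k = w -` {k}"
    unfolding u using decode_fibre[OF w, of m] wm k0 decode_bij_betw(1)[OF w k]
    by (intro the_inv_into_f_eq) (auto simp: bij_betw_def)
  then have "last_block (decode w) = w -` {k}"
    by (simp add: last_block_def decode_def decode_bij_betw(2)[OF w k])
  moreover have "Max {..k} = k" by (rule Max_eqI) auto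
  ultimately have Max: "Max (last_block (decode w)) = m"
    by (simp add: m_def last_max_def k)
  have f: "f (w -` {j}) = ?w' -` {j}" for j
    by (simp add: f_def squeeze_fibre erase_max_def m_def)
  \<comment> \<open>Discarding \<open>{m}\<close> matters exactly when the largest letter occurs
    once; that letter then also leaves the range of the erased word.\<close>
  have P: "?P = (\<lambda>j. w -` {j}) ` (range ?w' - {0})"
  proof (intro equalityI subsetI)
    fix V assume V: "V \<in> ?P"
    then obtain j where j: "V = w -` {j}" "j \<in> range w - {0}" by (auto simp: fibres_def)
    then obtain i where i: "w i = j" "i \<noteq> m" using V by auto
    then have "?w' (squeeze m i) = j" by (simp add: erase_max_def flip: m_def)
    then have "j \<in> range ?w' - {0}" using j(2) by blast
    then show "V \<in> (\<lambda>j. w -` {j}) ` (range ?w' - {0})" using j(1) by blast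
  next
    fix V assume "V \<in> (\<lambda>j. w -` {j}) ` (range ?w' - {0})"
    then obtain i where i: "V = w -` {?w' i}" "?w' i \<noteq> 0" by auto
    have "?w' i = w (skip m i)" by (simp add: erase_max_def m_def)
    then have "skip m i \<in> V" "V \<in> fibres w" using i by (auto simp: fibres_def)
    then show "V \<in> ?P" using skip_neq[of m i] by auto
  qed
  have fP: "f ` ?P = fibres ?w'"
    unfolding P image_image f by (simp add: fibres_def)
  \<comment> \<open>Letters in the range of the erased word have non-empty, pairwise disjoint fibres
    there, so the image determines the letter.\<close>
  have inj: "inj_on f ?P"
    unfolding P by (rule inj_onI) (use f in \<open>fastforce dest: equalityD1\<close>)
  have lab: "?u (the_inv_into ?P f B) = ?w' (Min B)" if B: "B \<in> fibres ?w'" for B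
  proof -
    obtain j where j: "B = ?w' -` {j}" "j \<in> range ?w' - {0}" using B unfolding fibres_def by blast
    have "the_inv_into ?P f B = w -` {j}"
      using j P f by (intro the_inv_into_f_eq[OF inj]) auto
    moreover have "?u (w -` {j}) = j"
      using decode_fibre(2)[OF w] j(2) unfolding u by (auto simp: erase_max_def)
    moreover have "snd (decode ?w') B = j"
      using decode_fibre(2)[OF w'] j by auto
    ultimately show ?thesis using B by (simp add: decode_def)
  qed
  have "parent (decode w) = (f ` ?P, restrict (\<lambda>B. ?u (the_inv_into ?P f B)) (f ` ?P))"
    using Max unfolding parent_def decode_def by (simp add: Let_def f_def[abs_def])
  also have "\<dots> = decode ?w'"
    unfolding fP decode_def[of ?w'] using restrict_ext[of "fibres ?w'", OF lab] by simp
  finally show ?thesis .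
qed

section \<open>Counting children\<close>

lemma parent_in_NC_mton:
  assumes "x \<in> NC_mton n" "n \<ge> 1"
  shows "parent x \<in> NC_mton (n - 1)"
proof -
  obtain w where w: "w \<in> words n" "decode w = x" using decode_surj[OF assms(1)] by blast
  then have "parent x = decode (erase_max w)" using parent_decode[OF w(1) assms(2)] by simp
  then show ?thesis using decode_in_NC_mton erase_max_in_words[OF w(1) assms(2)] by simp
qed

lemma card_children:
  assumes "x \<in> NC_mton (n - 1)" "n \<ge> 2"
  shows "card (children n x) = n + 1"
proof -
  obtain w where w: "w \<in> words (n - 1)" "decode w = x" using decode_surj assms(1) by blast
  have n1: "n \<ge> 1" using assms(2) by simp
  \<comment> \<open>Injectivity of \<open>decode\<close> on words of length \<open>n - 1\<close>
    turns equality of parents into equality of erased words.\<close>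
  have *: "parent (decode y) = x \<longleftrightarrow> erase_max y = w" if "y \<in> words n" for y
    using parent_decode[OF that n1] w erase_max_in_words[OF that n1]
    by (metis decode_inj inj_onD)
  have "children n x = decode ` {y \<in> words n. erase_max y = w}"
  proof (intro equalityI subsetI)
    fix z assume z: "z \<in> children n x"
    then obtain y where "y \<in> words n" "decode y = z"
      using decode_surj[of z n] unfolding children_def by blast
    then show "z \<in> decode ` {y \<in> words n. erase_max y = w}"
      using z * by (auto simp: children_def)
  next
    fix z assume "z \<in> decode ` {y \<in> words n. erase_max y = w}"
    then show "z \<in> children n x" using * decode_in_NC_mton by (auto simp: children_def)
  qed
  also have "card \<dots> = card {y \<in> words n. erase_max y = w}"
    by (rule card_image, rule inj_on_subset[OF decode_inj]) blast
  also have "\<dots> = n + 1" using card_erase_max_fibre[OF w(1) assms(2)] .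
  finally show ?thesis .
qed

text \<open>Extensionality of the orderings is essential: it places them in a finite product of
  finite sets.\<close>

lemma finite_NC_mton: "finite (NC_mton n)"
proof (rule finite_subset)
  show "NC_mton n \<subseteq> (SIGMA \<pi>:Pow (Pow {1..n}). \<pi> \<rightarrow>\<^sub>E {1..card \<pi>})"
  proof
    fix x assume "x \<in> NC_mton n"
    then obtain \<pi> u where x: "x = (\<pi>, u)" and part: "partition_on {1..n} \<pi>"
      and ext: "u \<in> extensional \<pi>" and bij: "bij_betw u \<pi> {1..card \<pi>}"
      by (auto simp: NC_mton_def NC_def monotonic_ordering_def)
    have "\<pi> \<subseteq> Pow {1..n}" using partition_onD1[OF part] by blast
    moreover have "u \<in> \<pi> \<rightarrow>\<^sub>E {1..card \<pi>}"
      using ext bij_betw_imp_funcset[OF bij] by (simp add: PiE_def)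
    ultimately show "x \<in> (SIGMA \<pi>:Pow (Pow {1..n}). \<pi> \<rightarrow>\<^sub>E {1..card \<pi>})" by (simp add: x)
  qed
  show "finite (SIGMA \<pi>:Pow (Pow {1..n}). \<pi> \<rightarrow>\<^sub>E {1..card \<pi>})"
    by (intro finite_SigmaI finite_PiE) (auto intro: finite_subset)
qed

section \<open>The recursion\<close>

lemma sum_NC_mton_children:
  assumes "n \<ge> 1"
  shows "sum g (NC_mton n) = (\<Sum>x\<in>NC_mton (n - 1). sum g (children n x))"
proof -
  have "parent ` NC_mton n \<subseteq> NC_mton (n - 1)" using parent_in_NC_mton assms by blast
  from sum.group[OF finite_NC_mton finite_NC_mton this, of g] show ?thesis
    by (simp add: children_def)
qed

lemma deriv_gen_fun:
  assumes "t > 0"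
  shows "deriv (gen_fun Z n) t = (\<Sum>x\<in>NC_mton n. Z n x * t powr (Z n x - 1))"
proof (rule DERIV_imp_deriv)
  show "(gen_fun Z n has_real_derivative (\<Sum>x\<in>NC_mton n. Z n x * t powr (Z n x - 1))) (at t)"
    unfolding gen_fun_def using assms
    by (auto intro!: DERIV_sum has_real_derivative_powr)
qed

theorem theorem6p1:
  fixes \<alpha> \<beta> q :: int
    and Z :: "nat \<Rightarrow> ordered_partition \<Rightarrow> real"
    and n :: nat and t :: real
  assumes "recursive_second_kind (of_int \<alpha>) (of_int \<beta>) (of_int q) Z"
    and "n \<ge> 2" and "t > 0"
  shows "gen_fun Z n t =
           (of_int q * t powr of_int \<alpha> + (real (n + 1) - of_int q) * t powr of_int \<beta>)
             * gen_fun Z (n - 1) t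
         + (t powr of_int (\<alpha> + 1) - t powr of_int (\<beta> + 1)) * deriv (gen_fun Z (n - 1)) t"
proof -
  let ?N = "NC_mton (n - 1)" and ?z = "Z (n - 1)"
  let ?A = "t powr of_int \<alpha>" and ?B = "t powr of_int \<beta>"
  have sum_children: "(\<Sum>y\<in>children n x. t powr Z n y) =
      (?z x + q) * t powr (?z x + \<alpha>) + (real (n + 1) - (?z x + q)) * t powr (?z x + \<beta>)"
    if x: "x \<in> ?N" for x
  proof -
    obtain C where C: "C \<subseteq> children n x" "\<forall>y\<in>C. Z n y = ?z x + \<alpha>"
      "\<forall>y\<in>children n x - C. Z n y = ?z x + \<beta>" "real (card C) = ?z x + q"
      using assms(1)[unfolded recursive_second_kind_def, rule_format, OF assms(2) x] by blast
    have card: "card (children n x) = n + 1" using card_children[OF x assms(2)] .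
    \<comment> \<open>An infinite set has \<open>card\<close> 0, so the positive count already gives
      finiteness.\<close>
    then have fin: "finite (children n x)" by (intro card_ge_0_finite) simp
    have "real (card (children n x - C)) = real (n + 1) - real (card C)"
      using C(1) card card_mono[OF fin C(1)] finite_subset[OF C(1) fin]
      by (simp add: card_Diff_subset of_nat_diff)
    moreover have "(\<Sum>y\<in>children n x. t powr Z n y) =
        (\<Sum>y\<in>children n x - C. t powr Z n y) + (\<Sum>y\<in>C. t powr Z n y)"
      using sum.subset_diff[OF C(1) fin] .
    ultimately show ?thesis using C by simp
  qed
  have "gen_fun Z n t = (\<Sum>x\<in>?N. (?z x + q) * t powr (?z x + \<alpha>)
      + (real (n + 1) - (?z x + q)) * t powr (?z x + \<beta>))"
    using assms(2) by (simp add: gen_fun_def sum_NC_mton_children sum_children)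
  \<comment> \<open>For each parent with value \<open>z\<close>, the terms carrying the factor
    \<open>z\<close> are rewritten by \<open>z * t powr (z + \<alpha>) = t powr (\<alpha> + 1) * (z
    * t powr (z - 1))\<close>, and likewise for \<open>\<beta>\<close>, to expose the summand of the
    derivative.\<close>
  also have "\<dots> = (\<Sum>x\<in>?N. (q * ?A + (real (n + 1) - q) * ?B) * t powr ?z x
      + (t powr of_int (\<alpha> + 1) - t powr of_int (\<beta> + 1)) * (?z x * t powr (?z x - 1)))"
    using assms(3) by (intro sum.cong refl) (simp add: powr_add powr_diff field_simps)
  also have "\<dots> = (q * ?A + (real (n + 1) - q) * ?B) * gen_fun Z (n - 1) t
      + (t powr of_int (\<alpha> + 1) - t powr of_int (\<beta> + 1)) * deriv (gen_fun Z (n - 1)) t"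
    by (simp add: deriv_gen_fun[OF assms(3)] gen_fun_def sum.distrib sum_distrib_left)
  finally show ?thesis .
qed

end
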